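(* Let $\gamma\equiv\gamma^{(2n)}=\{\gamma_{ij}\}_{i,j\in\mathbb{Z}_+^d,\,|i|+|j|\le2n}$ be a complex sequence, and suppose $M^d(n)\equiv M^d(n)(\gamma)\ge0$ admits a flat extension $$M^d(n+1)=\begin{pmatrix} M^d(n) & M^d(n)W \\ W^*M^d(n) & W^*M^d(n)W \end{pmatrix}.$$ Let $p\in\mathbb{C}^d[z,\bar z]$, with $\deg p=2k$ or $2k-1$. If $M_p^d(n+k)\ge0$, then $$M_p^d(n+k+1)=\begin{pmatrix} M_p^d(n+k) & M_p^d(n+k)W \\ W^*M_p^d(n+k) & W^*M_p^d(n+k)W \end{pmatrix};$$ in particular, $M_p^d(n+k+1)$ is a flat, positive extension of $M_p^d(n+k)$.
   Context: $\mathbb{C}_l^d[z,\bar z]$ is the space of complex polynomials of total degree $\le l$ in $z=(z_1,\dots,z_d)$, $\bar z=(\bar z_1,\dots,\bar z_d)$, with basis the monomials $\bar z^iz^j$, $|i|+|j|\le l$ ($i,j\in\mathbb{Z}_+^d$, $|i|=i_1+\dots+i_d$), ordered by degree (and lexicographically within each degree); $\hat f$ is the coefficient vector of $f$ in this basis. Riesz functional: $\Lambda_\gamma(\sum b_{rs}\bar z^rz^s)=\sum b_{rs}\gamma_{rs}$. The moment matrix $M^d(l)(\gamma)$ of a sequence of degree $2l$ has rows and columns indexed by the monomials of degree $\le l$ and is determined by $\langle M^d(l)(\gamma)\hat f,\hat g\rangle=\Lambda_\gamma(f\bar g)$, $f,g\in\mathbb{C}_l^d[z,\bar z]$. $A\ge0$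 means positive semidefinite. In block decompositions, the first block corresponds to monomials of degree $\le n$ and the second to monomials of degree $n+1$. A flat extension of a positive semidefinite matrix $A$ is a positive semidefinite block extension $\tilde A$ (with $A$ as upper-left corner) with $\operatorname{rank}\tilde A=\operatorname{rank}A$; equivalently it has the form $\begin{pmatrix} A & AW \\ W^*A & W^*AW \end{pmatrix}$ for some matrix $W$. A flat extension $M^d(n+1)$ of $M^d(n)(\gamma)$ is understood to be again a moment matrix, of a sequence of degree $2n+2$ extending $\gamma$. If $M^d(n)\ge0$ has a flat extension $M^d(n+1)$, then $M^d(n+1)$ has unique successive positive flat moment matrix extensions $M^d(n+2),M^d(n+3),\dots$; let $\tilde\gamma$ be the resulting full moment sequence. Localizing matrices: for $\deg p=2k$ or $2k-1$ and $l\ge k$, $M_p^d(l)$ (relative to $M^d(l)=M^d(l)(\tilde\gamma)$) has rows and columns indexed by the monomials of degree $\le l-k$ and is determined by $\langle M_p^d(l)\hat f,\hat g\rangle=\Lambda_{\tilde\gamma}(pf\bar g)$, $f,g\in\mathbb{C}_{l-k}^d[z,\bar z]$. Thus $M_p^d(n+k)$ and $M_p^d(n+k+1)$ have the same sizes as $M^d(n)$ and $M^d(n+1)$ respectively. *)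

theory Defs
  imports
    "HOL-Library.Poly_Mapping"
    "HOL-Library.Function_Algebras"
    "HOL-Library.Product_Plus"
    "HOL-Library.List_Lexorder"
    "Jordan_Normal_Form.DL_Rank"
    "Jordan_Normal_Form.Schur_Decomposition"
begin

section \<open>Polynomials in \<open>z\<close> and its conjugate\<close>

text \<open>
  The number of variables is the cardinality of the finite index type \<open>'d\<close>; its linear order
  is used only to order the monomials. The pair \<open>(r, s)\<close> stands for
  the monomial with exponent \<open>r\<close> on the conjugated variables and exponent \<open>s\<close> on the
  variables themselves; in the same way \<open>\<gamma> (r, s)\<close> is the moment with indices \<open>r\<close>, \<open>s\<close>.
\<close>

type_synonym 'd monomial = "('d \<Rightarrow> nat) \<times> ('d \<Rightarrow> nat)"
type_synonym 'd cpoly = "'d monomial \<Rightarrow>\<^sub>0 complex"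
type_synonym 'd mseq = "'d monomial \<Rightarrow> complex"

definition mdeg :: "'d::finite monomial \<Rightarrow> nat" where
  "mdeg m = (\<Sum>x\<in>UNIV. fst m x) + (\<Sum>x\<in>UNIV. snd m x)"

definition tdeg :: "'d::finite cpoly \<Rightarrow> nat" where
  "tdeg f = Max (insert 0 (mdeg ` Poly_Mapping.keys f))"

abbreviation mon :: "'d monomial \<Rightarrow> 'd cpoly" where
  "mon m \<equiv> Poly_Mapping.single m 1"

text \<open>Complex conjugation conjugates the coefficients and exchanges the two exponents.\<close>

definition pconj :: "'d cpoly \<Rightarrow> 'd cpoly" where
  "pconj f = Poly_Mapping.map_key prod.swap (Poly_Mapping.map cnj f)"

lemma lookup_pconj [simp]: "Poly_Mapping.lookup (pconj f) (r, s) = cnj (Poly_Mapping.lookup f (s, r))"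
  by (simp add: pconj_def map_key.rep_eq Poly_Mapping.map.rep_eq when_def)

definition riesz :: "'d mseq \<Rightarrow> 'd cpoly \<Rightarrow> complex" where
  "riesz \<gamma> f = (\<Sum>m\<in>Poly_Mapping.keys f. Poly_Mapping.lookup f m * \<gamma> m)"

text \<open>Monomials are ordered by degree, then lexicographically by the exponent tuple \<open>(r, s)\<close>.\<close>

definition mono_key :: "'d::{finite,linorder} monomial \<Rightarrow> nat list" where
  "mono_key m = (let xs = sorted_list_of_set UNIV
    in mdeg m # map (fst m) xs @ map (snd m) xs)"

definition monoms :: "nat \<Rightarrow> 'd::{finite,linorder} monomial list" where
  "monoms l = sorted_key_list_of_set mono_key {m. mdeg m \<le> l}"

definition coeff_vec :: "nat \<Rightarrow> 'd::{finite,linorder} cpoly \<Rightarrow> complex vec" where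
  "coeff_vec l f = vec (length (monoms l :: 'd monomial list))
     (\<lambda>i. Poly_Mapping.lookup f (monoms l ! i))"


section \<open>Moment and localizing matrices\<close>

text \<open>
  The matrix of the sesquilinear form sending \<open>(f, g)\<close> to \<open>riesz \<gamma> (p * f * pconj g)\<close> on polynomials
  of degree at most \<open>l\<close>; see \<open>form_matrix_inner\<close> and \<open>form_matrix_unique\<close> below.
\<close>

definition form_matrix :: "'d::{finite,linorder} mseq \<Rightarrow> 'd cpoly \<Rightarrow> nat \<Rightarrow> complex mat" where
  "form_matrix \<gamma> p l = (let N = length (monoms l :: 'd monomial list) in
     mat N N (\<lambda>(i, j). riesz \<gamma> (p * mon (monoms l ! j) * pconj (mon (monoms l ! i)))))"

definition moment_matrix :: "'d::{finite,linorder} mseq \<Rightarrow> nat \<Rightarrow> complex mat" where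
  "moment_matrix \<gamma> l = form_matrix \<gamma> 1 l"

text \<open>The integer \<open>k\<close> such that the degree of \<open>p\<close> is \<open>2 k\<close> or \<open>2 k - 1\<close>.\<close>

definition half_deg :: "'d::finite cpoly \<Rightarrow> nat" where
  "half_deg p = (tdeg p + 1) div 2"

text \<open>Only meaningful for \<open>l \<ge> half_deg p\<close>.\<close>

definition localizing_matrix :: "'d::{finite,linorder} mseq \<Rightarrow> 'd cpoly \<Rightarrow> nat \<Rightarrow> complex mat" where
  "localizing_matrix \<gamma> p l = form_matrix \<gamma> p (l - half_deg p)"


section \<open>Positivity and flat extensions\<close>

text \<open>The order on \<^typ>\<open>complex\<close> makes \<open>0 \<le> c\<close> mean that \<open>c\<close> is real and nonnegative.\<close>

definition psd :: "complex mat \<Rightarrow> bool" where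
  "psd A \<longleftrightarrow> square_mat A \<and> (\<forall>v\<in>carrier_vec (dim_row A). 0 \<le> (A *\<^sub>v v) \<bullet>c v)"

definition mat_rank :: "complex mat \<Rightarrow> nat" where
  "mat_rank A = vec_space.rank (dim_row A) A"

definition block_extension :: "complex mat \<Rightarrow> complex mat \<Rightarrow> bool" where
  "block_extension A A' \<longleftrightarrow> (\<exists>m B C D.
     B \<in> carrier_mat (dim_row A) m \<and> C \<in> carrier_mat m (dim_col A) \<and> D \<in> carrier_mat m m \<and>
     A' = four_block_mat A B C D)"

definition flat_extension :: "complex mat \<Rightarrow> complex mat \<Rightarrow> bool" where
  "flat_extension A A' \<longleftrightarrow> block_extension A A' \<and> psd A' \<and> mat_rank A' = mat_rank A"

definition flat_block :: "complex mat \<Rightarrow> complex mat \<Rightarrow> complex mat" where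
  "flat_block A W = four_block_mat A (A * W) (mat_adjoint W * A) (mat_adjoint W * A * W)"

text \<open>
  Sequences are total functions; a sequence of degree \<open>l\<close> is represented by any function
  with the prescribed values on indices of total degree at most \<open>l\<close>.
\<close>

definition extends_seq :: "nat \<Rightarrow> 'd::finite mseq \<Rightarrow> 'd mseq \<Rightarrow> bool" where
  "extends_seq l \<gamma> \<gamma>' \<longleftrightarrow> (\<forall>m. mdeg m \<le> l \<longrightarrow> \<gamma>' m = \<gamma> m)"

text \<open>
  \<open>\<gamma>t\<close> is the full sequence obtained from the sequence \<open>\<gamma>\<close> of degree \<open>2 l\<close> by successive
  positive flat moment matrix extensions.
\<close>

definition full_flat_extension :: "nat \<Rightarrow> 'd::{finite,linorder} mseq \<Rightarrow> 'd mseq \<Rightarrow> bool" where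
  "full_flat_extension l \<gamma> \<gamma>t \<longleftrightarrow> extends_seq (2 * l) \<gamma> \<gamma>t \<and>
     (\<forall>j\<ge>l. flat_extension (moment_matrix \<gamma>t j) (moment_matrix \<gamma>t (j + 1)))"


section \<open>Basic facts\<close>

lemma finite_mdeg_le: "finite {m :: 'd::finite monomial. mdeg m \<le> l}"
proof -
  let ?F = "PiE (UNIV :: 'd set) (\<lambda>_. {..l})"
  have "m \<in> ?F \<times> ?F" if "mdeg m \<le> l" for m :: "'d monomial"
  proof -
    have "fst m x \<le> (\<Sum>x\<in>UNIV. fst m x)" "snd m x \<le> (\<Sum>x\<in>UNIV. snd m x)" for x
      by (auto intro: member_le_sum)
    moreover have "(\<Sum>x\<in>UNIV. fst m x) \<le> l" "(\<Sum>x\<in>UNIV. snd m x) \<le> l"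
      using that by (auto simp: mdeg_def)
    ultimately have "fst m x \<le> l" "snd m x \<le> l" for x
      by (meson le_trans)+
    then show ?thesis by (auto simp: PiE_def Pi_def mem_Times_iff)
  qed
  then have "{m :: 'd monomial. mdeg m \<le> l} \<subseteq> ?F \<times> ?F" by blast
  moreover have "finite (?F \<times> ?F)" by (intro finite_cartesian_product finite_PiE) auto
  ultimately show ?thesis by (rule finite_subset)
qed

lemma inj_mono_key: "inj (mono_key :: 'd::{finite,linorder} monomial \<Rightarrow> _)"
proof (rule injI)
  fix a b :: "'d monomial"
  assume "mono_key a = mono_key b"
  then have *: "\<forall>x\<in>set (sorted_list_of_set (UNIV :: 'd set)). fst a x = fst b x \<and> snd a x = snd b x"
    by (auto simp: mono_key_def Let_def)
  then have "fst a = fst b" "snd a = snd b" by (auto simp: fun_eq_iff)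
  then show "a = b" by (rule prod_eqI)
qed

lemma insort_key_linorder: "linorder.insort_key (\<le>) = (insort_key :: ('b \<Rightarrow> 'a::linorder) \<Rightarrow> _)"
proof (intro ext)
  fix f :: "'b \<Rightarrow> 'a" and x xs
  show "linorder.insort_key (\<le>) f x xs = insort_key f x xs"
    by (induction xs) (simp_all add: linorder.insort_key.simps[OF linorder_class.linorder_axioms])
qed

interpretation monoms: folding_insort_key "(\<le>)" "(<)" UNIV "mono_key :: 'd::{finite,linorder} monomial \<Rightarrow> nat list"
  rewrites "linorder.sorted_key_list_of_set (\<le>) = (sorted_key_list_of_set :: ('d monomial \<Rightarrow> nat list) \<Rightarrow> _)"
proof -
  show "folding_insort_key (\<le>) (<) UNIV (mono_key :: 'd monomial \<Rightarrow> nat list)"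
    by unfold_locales (rule inj_mono_key)
  show "linorder.sorted_key_list_of_set (\<le>) = (sorted_key_list_of_set :: ('d monomial \<Rightarrow> nat list) \<Rightarrow> _)"
    by (rule ext)
      (simp only: linorder.sorted_key_list_of_set_def[OF linorder_class.linorder_axioms]
        sorted_key_list_of_set_def insort_key_linorder)
qed

lemma set_monoms [simp]: "set (monoms l) = {m :: 'd::{finite,linorder} monomial. mdeg m \<le> l}"
  unfolding monoms_def by (rule monoms.set_sorted_key_list_of_set) (auto simp: finite_mdeg_le)

lemma distinct_monoms [simp]: "distinct (monoms l :: 'd::{finite,linorder} monomial list)"
  unfolding monoms_def
  using monoms.distinct_sorted_key_list_of_set[of "{m :: 'd monomial. mdeg m \<le> l}"]
  by (auto simp: distinct_map)

lemma length_monoms: "length (monoms l :: 'd::{finite,linorder} monomial list) = card {m :: 'd monomial. mdeg m \<le> l}"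
  using distinct_card[OF distinct_monoms[where 'd='d, of l]] by simp

lemma monoms_Suc:
  "monoms (Suc l) = monoms l @
     sorted_key_list_of_set mono_key {m :: 'd::{finite,linorder} monomial. mdeg m = Suc l}"
proof -
  let ?A = "{m :: 'd monomial. mdeg m \<le> l}" and ?B = "{m :: 'd monomial. mdeg m = Suc l}"
  have fB: "finite ?B" by (rule finite_subset[OF _ finite_mdeg_le[of "Suc l"]]) auto
  note fA = finite_mdeg_le[of l]
  let ?ys = "sorted_key_list_of_set mono_key ?B"
  have sA: "set (monoms l) = ?A" by simp
  have sB: "set ?ys = ?B" by (rule monoms.set_sorted_key_list_of_set) (auto simp: fB)
  have "sorted_wrt (<) (map mono_key (monoms l @ ?ys))"
    unfolding map_append sorted_wrt_append
  proof (intro conjI ballI)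
    show "sorted_wrt (<) (map mono_key (monoms l :: 'd monomial list))"
      unfolding monoms_def by (rule monoms.strict_sorted_key_list_of_set) simp
    show "sorted_wrt (<) (map mono_key ?ys)"
      by (rule monoms.strict_sorted_key_list_of_set) simp
    fix x y assume "x \<in> set (map mono_key (monoms l :: 'd monomial list))" "y \<in> set (map mono_key ?ys)"
    then show "x < y" unfolding set_map sA sB by (auto simp: mono_key_def Let_def)
  qed
  moreover have "set (monoms l @ ?ys) = {m :: 'd monomial. mdeg m \<le> Suc l}"
    unfolding set_append sA sB by (auto simp: le_Suc_eq)
  moreover have "length (monoms l @ ?ys) = card {m :: 'd monomial. mdeg m \<le> Suc l}"
  proof -
    have "length ?ys = card ?B" by (rule monoms.length_sorted_key_list_of_set) (auto simp: fB)
    moreover have "card (?A \<union> ?B) = card ?A + card ?B"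
      by (rule card_Un_disjoint) (use fA fB in auto)
    moreover have "?A \<union> ?B = {m :: 'd monomial. mdeg m \<le> Suc l}" by (auto simp: le_Suc_eq)
    ultimately show ?thesis by (simp only: length_append length_monoms)
  qed
  ultimately have "sorted_key_list_of_set mono_key {m :: 'd monomial. mdeg m \<le> Suc l} = monoms l @ ?ys"
    by (intro monoms.sorted_key_list_of_set_unique[THEN iffD1, OF _ finite_mdeg_le] conjI subset_UNIV)
  then show ?thesis by (simp only: monoms_def)
qed

lemma tdeg_le_iff: "tdeg f \<le> l \<longleftrightarrow> Poly_Mapping.keys f \<subseteq> {m. mdeg m \<le> l}"
  by (auto simp: tdeg_def)

lemma riesz_superset:
  assumes "finite S" "Poly_Mapping.keys f \<subseteq> S"
  shows "riesz \<gamma> f = (\<Sum>m\<in>S. Poly_Mapping.lookup f m * \<gamma> m)"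
  unfolding riesz_def using assms
  by (intro sum.mono_neutral_left) (auto simp: in_keys_iff)

lemma riesz_add: "riesz \<gamma> (f + g) = riesz \<gamma> f + riesz \<gamma> g"
proof -
  let ?S = "Poly_Mapping.keys f \<union> Poly_Mapping.keys g"
  have "Poly_Mapping.keys (f + g) \<subseteq> ?S" by (rule Poly_Mapping.keys_add)
  then show ?thesis
    by (subst (1 2 3) riesz_superset[of ?S])
       (auto simp: lookup_add distrib_right sum.distrib)
qed

lemma riesz_0 [simp]: "riesz \<gamma> 0 = 0"
  by (simp add: riesz_def)

lemma riesz_sum: "riesz \<gamma> (sum F S) = (\<Sum>i\<in>S. riesz \<gamma> (F i))"
  by (induction S rule: infinite_finite_induct) (auto simp: riesz_add)

lemma lookup_const_mult:
  "Poly_Mapping.lookup (Poly_Mapping.single 0 c * f) m = c * Poly_Mapping.lookup (f :: 'd cpoly) m"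
proof -
  have "Poly_Mapping.single 0 c * f = Poly_Mapping.map ((*) c) f"
    by (rule mult_map_scale_conv_mult[symmetric])
  then show ?thesis by (simp add: Poly_Mapping.map.rep_eq when_def)
qed

lemma riesz_const_mult: "riesz \<gamma> (Poly_Mapping.single 0 c * f) = c * riesz \<gamma> (f :: 'd cpoly)"
proof -
  have "Poly_Mapping.keys (Poly_Mapping.single 0 c * f) \<subseteq> Poly_Mapping.keys f"
    by (auto simp: in_keys_iff lookup_const_mult)
  then show ?thesis
    by (subst riesz_superset[of "Poly_Mapping.keys f"])
       (auto simp: lookup_const_mult riesz_def sum_distrib_left mult.assoc)
qed

lemma pconj_mon: "pconj (Poly_Mapping.single (m :: 'a monomial) c) = Poly_Mapping.single (prod.swap m) (cnj c)"
proof (rule poly_mapping_eqI)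
  fix x :: "'a monomial"
  obtain r s where x: "x = (r, s)" by (cases x)
  obtain r' s' where m: "m = (r', s')" by (cases m)
  show "Poly_Mapping.lookup (pconj (Poly_Mapping.single m c)) x
    = Poly_Mapping.lookup (Poly_Mapping.single (prod.swap m) (cnj c)) x"
    unfolding x m by (auto simp: lookup_single when_def)
qed

lemma pconj_add: "pconj (f + g) = pconj f + pconj g"
  by (rule poly_mapping_eqI) (auto simp: lookup_add)

lemma pconj_0 [simp]: "pconj 0 = 0"
  by (rule poly_mapping_eqI) auto

lemma pconj_sum: "pconj (sum F S) = (\<Sum>i\<in>S. pconj (F i))"
  by (induction S rule: infinite_finite_induct) (auto simp: pconj_add)

lemma poly_expand:
  fixes f :: "'d::{finite,linorder} cpoly"
  assumes "tdeg f \<le> l"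
  shows "f = (\<Sum>i<length (monoms l :: 'd monomial list).
    Poly_Mapping.single 0 (Poly_Mapping.lookup f (monoms l ! i)) * mon (monoms l ! i))"
proof (rule poly_mapping_eqI)
  fix m :: "'d monomial"
  have "Poly_Mapping.lookup (\<Sum>i<length (monoms l :: 'd monomial list).
      Poly_Mapping.single 0 (Poly_Mapping.lookup f (monoms l ! i)) * mon (monoms l ! i)) m
    = (\<Sum>i<length (monoms l :: 'd monomial list). Poly_Mapping.lookup f (monoms l ! i)
         * (if monoms l ! i = m then 1 else 0))"
    by (auto simp: lookup_sum lookup_const_mult lookup_single when_def intro!: sum.cong)
  also have "\<dots> = (\<Sum>x\<in>set (monoms l). Poly_Mapping.lookup f x * (if x = m then 1 else 0))"
    by (rule sum.reindex_bij_betw[OF bij_betw_nth]) auto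
  also have "\<dots> = (\<Sum>x\<in>set (monoms l). if x = m then Poly_Mapping.lookup f m else 0)"
    by (rule sum.cong) auto
  also have "\<dots> = Poly_Mapping.lookup f m"
    using assms by (auto simp: sum.delta finite_mdeg_le tdeg_le_iff in_keys_iff)
  finally show "Poly_Mapping.lookup f m = Poly_Mapping.lookup (\<Sum>i<length (monoms l :: 'd monomial list).
      Poly_Mapping.single 0 (Poly_Mapping.lookup f (monoms l ! i)) * mon (monoms l ! i)) m" by simp
qed

lemma form_matrix_carrier:
  fixes p :: "'d::{finite,linorder} cpoly" and l :: nat
  defines "N \<equiv> length (monoms l :: 'd monomial list)"
  shows "form_matrix \<gamma> p l \<in> carrier_mat N N"
  by (simp add: form_matrix_def Let_def N_def)

lemma form_matrix_inner:
  fixes p f g :: "'d::{finite,linorder} cpoly"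
  assumes "tdeg f \<le> l" "tdeg g \<le> l"
  shows "(form_matrix \<gamma> p l *\<^sub>v coeff_vec l f) \<bullet>c coeff_vec l g = riesz \<gamma> (p * f * pconj g)"
proof -
  let ?N = "length (monoms l :: 'd monomial list)"
  let ?c = "\<lambda>f i. Poly_Mapping.lookup f (monoms l ! i :: 'd monomial)"
  let ?S = "\<lambda>c. Poly_Mapping.single (0 :: 'd monomial) (c :: complex)"
  let ?m = "\<lambda>i. mon (monoms l ! i :: 'd monomial)"
  have cg: "pconj g = (\<Sum>i<?N. ?S (cnj (?c g i)) * pconj (?m i))"
  proof -
    have sw: "prod.swap (0 + x) = 0 + prod.swap x" for x :: "'d monomial"
      by (cases x) (simp add: zero_prod_def)
    show ?thesis
      by (subst poly_expand[OF assms(2)]) (simp add: pconj_sum pconj_mon mult_single sw)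
  qed
  have "p * f * pconj g = p * (\<Sum>j<?N. ?S (?c f j) * ?m j) * (\<Sum>i<?N. ?S (cnj (?c g i)) * pconj (?m i))"
    using poly_expand[OF assms(1)] cg by metis
  also have "\<dots> = (\<Sum>i<?N. \<Sum>j<?N. ?S (cnj (?c g i)) * (?S (?c f j) * (p * ?m j * pconj (?m i))))"
    by (simp add: sum_distrib_left sum_distrib_right mult_ac)
  finally have "riesz \<gamma> (p * f * pconj g) = (\<Sum>i<?N. \<Sum>j<?N. cnj (?c g i) * (?c f j * riesz \<gamma> (p * ?m j * pconj (?m i))))"
    by (simp only: riesz_sum riesz_const_mult)
  then show ?thesis
    by (simp add: form_matrix_def Let_def coeff_vec_def scalar_prod_def sum_distrib_left
        sum_distrib_right mult_ac atLeast0LessThan)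
qed

lemma form_matrix_unique:
  fixes p :: "'d::{finite,linorder} cpoly" and l :: nat
  defines "N \<equiv> length (monoms l :: 'd monomial list)"
  assumes M: "M \<in> carrier_mat N N"
    and eq: "\<And>f g. tdeg f \<le> l \<Longrightarrow> tdeg g \<le> l \<Longrightarrow>
      (M *\<^sub>v coeff_vec l f) \<bullet>c coeff_vec l g = riesz \<gamma> (p * f * pconj g)"
  shows "M = form_matrix \<gamma> p l"
proof (rule eq_matI)
  have u: "coeff_vec l (mon (monoms l ! i :: 'd monomial)) = unit_vec N i"
    "tdeg (mon (monoms l ! i :: 'd monomial)) \<le> l" if "i < N" for i
  proof -
    show "coeff_vec l (mon (monoms l ! i :: 'd monomial)) = unit_vec N i"
      using that by (auto simp: coeff_vec_def unit_vec_def N_def lookup_single when_def nth_eq_iff_index_eq intro!: eq_vecI)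
    have "(monoms l ! i :: 'd monomial) \<in> set (monoms l)" using that N_def nth_mem by blast
    then show "tdeg (mon (monoms l ! i :: 'd monomial)) \<le> l" by (simp add: tdeg_le_iff)
  qed
  fix i j assume "i < dim_row (form_matrix \<gamma> p l)" "j < dim_col (form_matrix \<gamma> p l)"
  then have ij: "i < N" "j < N" by (auto simp: form_matrix_def Let_def N_def)
  have "conjugate (unit_vec N i) = (unit_vec N i :: complex vec)"
    by (auto simp: unit_vec_def)
  then have "(M *\<^sub>v unit_vec N j) \<bullet>c unit_vec N i = M $$ (i, j)"
    using M ij by (simp add: scalar_prod_right_unit)
  then show "M $$ (i, j) = form_matrix \<gamma> p l $$ (i, j)"
    using eq[OF u(2)[OF ij(2)] u(2)[OF ij(1)]] u(1)[OF ij(1)] u(1)[OF ij(2)] ij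
    by (simp add: form_matrix_def Let_def N_def)
qed (use M in \<open>auto simp: form_matrix_def Let_def N_def\<close>)

end

theory Submission
  imports Defs
begin

text \<open>
  Write \<open>R = (I W)\<close>, so that the flat block extension of \<open>A\<close> by \<open>W\<close> is \<open>R\<^sup>* A R\<close>. The columns of \<open>R\<close>
  are the coefficient vectors of polynomials \<open>F j\<close> of degree at most \<open>n\<close>, and flatness of the moment
  matrix says that the differences \<open>M j - F j\<close> with the monomials \<open>M j\<close> of degree at most \<open>n + 1\<close>
  are null vectors of the form \<open>(f, g) \<mapsto> \<Lambda>(f g\<^sup>*)\<close>. All moment matrices of the full sequence being
  positive semidefinite, the Cauchy--Schwarz argument yields \<open>\<Lambda>((M j - F j) h) = 0\<close> for every
  polynomial \<open>h\<close> of any degree. Taking \<open>h\<close> divisible by \<open>p\<close>, each \<open>M j\<close> may be replaced by \<open>F j\<close> in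
  the localizing matrix as well, which therefore equals \<open>R\<^sup>* P R\<close>.
\<close>

section \<open>Rank of matrix products and rank factorization\<close>

context vec_space
begin

text \<open>Every column of \<open>B * C\<close> is a combination of the \<open>r\<close> columns of
  \<open>B\<close>, so the exchange lemma bounds any independent set of columns.\<close>

lemma rank_mult_le:
  assumes B: "B \<in> carrier_mat n r" and C: "C \<in> carrier_mat r nc"
  shows "rank (B * C) \<le> r"
proof -
  have BC: "B * C \<in> carrier_mat n nc" using B C by simp
  have cB: "set (cols B) \<subseteq> carrier_vec n" using cols_dim[of B] B by auto
  obtain S where S: "maximal S (\<lambda>T. T \<subseteq> set (cols (B * C)) \<and> lin_indpt T)"
    using maximal_exists_superset[of "set (cols (B * C))" "\<lambda>T. T \<subseteq> set (cols (B * C)) \<and> lin_indpt T" "{}"]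
    by (auto simp: finite_lin_indpt2)
  then have Sc: "S \<subseteq> set (cols (B * C))" and li: "lin_indpt S" by (auto simp: maximal_def)
  have "set (cols (B * C)) \<subseteq> span (set (cols B))"
  proof
    fix v assume "v \<in> set (cols (B * C))"
    then obtain j where j: "j < nc" "v = col (B * C) j"
      using BC by (auto simp: in_set_conv_nth)
    then have "v = B *\<^sub>v vec r (\<lambda>i. C $$ (i, j))"
      using B C by (auto simp: col_def)
    also have "\<dots> = lincomb_list (\<lambda>i. C $$ (i, j)) (cols B)"
      using lincomb_list_as_mat_mult[of "cols B" "\<lambda>i. C $$ (i, j)"] B cB
        mat_of_cols_cols[of B] by (auto simp: carrier_vecD subset_iff)
    finally have "v \<in> span_list (cols B)" by (auto simp: span_list_def)
    then show "v \<in> span (set (cols B))" using span_list_as_span[OF cB] by simp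
  qed
  then have Ss: "S \<subseteq> span (set (cols B))" using Sc by auto
  \<comment> \<open>The exchange lemma needs a generating set of the whole space, so it is applied
    inside the span of the columns of \<open>B\<close>.\<close>
  let ?V = "span_vs (set (cols B))"
  interpret sp: vectorspace class_ring ?V
    using span_is_subspace[OF cB] subspace_is_vs by blast
  have "card S \<le> card (set (cols B))"
  proof (rule sp.li_smaller_than_gen)
    show "finite S" using Sc finite_subset by blast
    show "set (cols B) \<subseteq> carrier ?V" using in_own_span[OF cB] by simp
    show "sp.lin_indpt S"
      using span_li_not_depend(2)[OF Ss span_is_submodule[OF cB]] li by simp
    show "sp.gen_set (set (cols B))"
      using span_li_not_depend(1)[OF in_own_span[OF cB] span_is_submodule[OF cB]] by simp
  qed (use Ss in auto)
  also have "\<dots> \<le> r" using card_length[of "cols B"] B by simp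
  finally show ?thesis using rank_card_indpt[OF BC S] by simp
qed

text \<open>The columns of \<open>B\<close> are a maximal independent set of columns of
  \<open>A\<close>; column \<open>j\<close> of \<open>C\<close> holds the coordinates of column
  \<open>j\<close> of \<open>A\<close> in them.\<close>

lemma rank_factorization:
  assumes A: "A \<in> carrier_mat n nc"
  obtains B C where "B \<in> carrier_mat n (rank A)" "C \<in> carrier_mat (rank A) nc" "A = B * C"
proof -
  have cA: "set (cols A) \<subseteq> carrier_vec n" using cols_dim[of A] A by auto
  obtain S where S: "maximal S (\<lambda>T. T \<subseteq> set (cols A) \<and> lin_indpt T)"
    using maximal_exists_superset[of "set (cols A)" "\<lambda>T. T \<subseteq> set (cols A) \<and> lin_indpt T" "{}"]
    by (auto simp: finite_lin_indpt2)
  then have Sc: "S \<subseteq> set (cols A)" and li: "lin_indpt S" by (auto simp: maximal_def)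
  have Sn: "S \<subseteq> carrier_vec n" using Sc cA by auto
  obtain ws where ws: "set ws = S" "distinct ws"
    using finite_distinct_list[of S] finite_subset[OF Sc] by auto
  have len: "length ws = rank A" using rank_card_indpt[OF A S] ws distinct_card by metis
  define B where "B = mat_of_cols n ws"
  have "\<exists>c. col A j = B *\<^sub>v vec (rank A) c" if j: "j < nc" for j
  proof -
    have mem: "col A j \<in> set (cols A)" using j A by (auto simp: cols_def)
    have "col A j \<in> span S"
    \<comment> \<open>A column outside the span could be added to \<open>S\<close> without losing
      independence, against maximality.\<close>
    proof (rule ccontr)
      assume n: "col A j \<notin> span S"
      then have "col A j \<notin> S" using in_own_span[OF Sn] by auto
      moreover have "lin_indpt (insert (col A j) S)"
        using lin_dep_iff_in_span[of S "col A j"] n li Sn mem cA calculation by auto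
      ultimately show False using S mem Sc unfolding maximal_def by blast
    qed
    then have "col A j \<in> span_list ws" using span_list_as_span[of ws] ws Sn by simp
    then obtain c where "col A j = lincomb_list c ws" by (auto simp: span_list_def)
    then show ?thesis using lincomb_list_as_mat_mult[of ws c] ws Sn len
      by (auto simp: B_def carrier_vecD subset_iff)
  qed
  then obtain c where c: "\<And>j. j < nc \<Longrightarrow> col A j = B *\<^sub>v vec (rank A) (c j)" by metis
  define C where "C = mat (rank A) nc (\<lambda>(i, j). c j i)"
  have B: "B \<in> carrier_mat n (rank A)" unfolding B_def len[symmetric] by (rule mat_of_cols_carrier)
  have C: "C \<in> carrier_mat (rank A) nc" by (simp add: C_def)
  have "A = B * C"
  proof (rule mat_col_eqI)
    fix j assume "j < dim_col (B * C)"
    then have j: "j < nc" using C by simp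
    have "col C j = vec (rank A) (c j)" using j by (auto simp: C_def)
    then show "col A j = col (B * C) j" using c[OF j] col_mult2[OF B C j] by simp
  qed (use A B C in auto)
  with B C show ?thesis by (rule that)
qed

end

text \<open>With \<open>A = B * C\<close> of inner dimension \<open>mat_rank A\<close>, the product
  regroups as \<open>(X * B) * (C * Y)\<close> with the same inner dimension.\<close>

lemma mat_rank_mult_mult_le:
  assumes X: "X \<in> carrier_mat a b" and A: "A \<in> carrier_mat b c" and Y: "Y \<in> carrier_mat c d"
  shows "mat_rank (X * A * Y) \<le> mat_rank A"
proof -
  have rk: "mat_rank A = vec_space.rank b A" using A by (simp add: mat_rank_def)
  obtain B C where BC: "B \<in> carrier_mat b (mat_rank A)" "C \<in> carrier_mat (mat_rank A) c" "A = B * C"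
    by (rule vec_space.rank_factorization[OF A, folded rk])
  have "X * A * Y = (X * B) * (C * Y)"
    unfolding BC(3) assoc_mult_mat[OF X BC(1,2), symmetric]
    by (rule assoc_mult_mat[OF mult_carrier_mat[OF X BC(1)] BC(2) Y])
  moreover have "vec_space.rank a ((X * B) * (C * Y)) \<le> mat_rank A"
    by (rule vec_space.rank_mult_le[of _ _ _ _ d]) (use X Y BC in auto)
  ultimately show ?thesis using X by (simp add: mat_rank_def)
qed

section \<open>Adjoints, and the flat block extension as a congruence\<close>

lemma mat_adjoint_carrier [simp]: "A \<in> carrier_mat nr nc \<Longrightarrow> mat_adjoint A \<in> carrier_mat nc nr"
  by (auto simp: mat_adjoint_def)

lemma dim_mat_adjoint [simp]: "dim_row (mat_adjoint A) = dim_col A" "dim_col (mat_adjoint A) = dim_row A"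
  by (simp_all add: mat_adjoint_def)

lemma index_mat_adjoint:
  "i < dim_col A \<Longrightarrow> j < dim_row A \<Longrightarrow> mat_adjoint A $$ (i, j) = conjugate (A $$ (j, i))"
  by (simp add: mat_adjoint_def mat_of_rows_index)

lemma mat_adjoint_cscalar_prod:
  fixes X :: "'a::conjugatable_field mat"
  assumes X: "X \<in> carrier_mat a b" and u: "u \<in> carrier_vec a" and v: "v \<in> carrier_vec b"
  shows "(mat_adjoint X *\<^sub>v u) \<bullet>c v = u \<bullet>c (X *\<^sub>v v)"
proof -
  have "(mat_adjoint X *\<^sub>v u) \<bullet>c v = (\<Sum>i<b. (\<Sum>j<a. conjugate (X $$ (j, i)) * u $ j) * conjugate (v $ i))"
    using assms
    by (simp add: scalar_prod_def atLeast0LessThan index_mat_adjoint)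
  also have "\<dots> = (\<Sum>i<b. \<Sum>j<a. u $ j * (conjugate (X $$ (j, i)) * conjugate (v $ i)))"
    by (simp add: sum_distrib_right sum_distrib_left mult_ac)
  also have "\<dots> = (\<Sum>j<a. \<Sum>i<b. u $ j * (conjugate (X $$ (j, i)) * conjugate (v $ i)))"
    by (rule sum.swap)
  also have "\<dots> = u \<bullet>c (X *\<^sub>v v)"
    using assms
    by (simp add: scalar_prod_def atLeast0LessThan sum_distrib_left conjugate_dist_mul sum_conjugate)
  finally show ?thesis .
qed

text \<open>This is \<open>R = (I W)\<close>. The empty lower blocks make it a four-block matrix, so
  that the block multiplication rule applies.\<close>

definition flat_cols :: "complex mat \<Rightarrow> complex mat" where
  "flat_cols W = four_block_mat (1\<^sub>m (dim_row W)) W (0\<^sub>m 0 (dim_row W)) (0\<^sub>m 0 (dim_col W))"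

lemma flat_cols_carrier [simp]: "W \<in> carrier_mat N m \<Longrightarrow> flat_cols W \<in> carrier_mat N (N + m)"
  by (auto simp: flat_cols_def)

lemma flat_cols_unit: "W \<in> carrier_mat N m \<Longrightarrow> a < N \<Longrightarrow> j < N \<Longrightarrow>
   flat_cols W $$ (a, j) = (if a = j then 1 else 0)"
  by (auto simp: flat_cols_def)

lemma flat_block_eq:
  assumes A: "A \<in> carrier_mat N N" and W: "W \<in> carrier_mat N m"
  shows "flat_block A W = mat_adjoint (flat_cols W) * A * flat_cols W"
proof -
  have W': "mat_adjoint W \<in> carrier_mat m N" using W by simp
  have R: "mat_adjoint (flat_cols W)
    = four_block_mat (1\<^sub>m N) (0\<^sub>m N 0) (mat_adjoint W) (0\<^sub>m m 0)" (is "_ = ?L")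
    using W W' flat_cols_carrier[OF W] mat_adjoint_carrier[OF flat_cols_carrier[OF W]]
    by (intro eq_matI) (auto simp: index_mat_adjoint flat_cols_def)
  \<comment> \<open>Padding \<open>A\<close> with empty blocks makes its block shape match that of
    the adjoint of \<open>R\<close>.\<close>
  have "A = four_block_mat A (0\<^sub>m N 0) (0\<^sub>m 0 N) (0\<^sub>m 0 0)" (is "_ = ?A")
    using A by (intro eq_matI) auto
  then have "mat_adjoint (flat_cols W) * A = ?L * ?A" using R by simp
  also have "\<dots> = four_block_mat A (0\<^sub>m N 0) (mat_adjoint W * A) (0\<^sub>m m 0)"
    using A W' right_mult_zero_mat[OF W', of 0]
    by (subst mult_four_block_mat[of _ N N _ 0 _ m _ _ N _ 0]) auto
  finally have "mat_adjoint (flat_cols W) * A * flat_cols W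
    = four_block_mat A (0\<^sub>m N 0) (mat_adjoint W * A) (0\<^sub>m m 0)
      * four_block_mat (1\<^sub>m N) W (0\<^sub>m 0 N) (0\<^sub>m 0 m)"
    using W by (simp add: flat_cols_def)
  also have "\<dots> = flat_block A W"
    unfolding flat_block_def
    using A W W' by (subst mult_four_block_mat[of _ N N _ 0 _ m _ _ N _ m]) auto
  finally show ?thesis by simp
qed

text \<open>The form of the congruent matrix at \<open>v\<close> is the form of \<open>A\<close> at
  \<open>R v\<close>.\<close>

lemma psd_flat_block:
  assumes A: "A \<in> carrier_mat N N" and W: "W \<in> carrier_mat N m" and "psd A"
  shows "psd (flat_block A W)"
proof -
  let ?R = "flat_cols W"
  have R: "?R \<in> carrier_mat N (N + m)" and R': "mat_adjoint ?R \<in> carrier_mat (N + m) N"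
    using W by auto
  have c: "flat_block A W \<in> carrier_mat (N + m) (N + m)"
    unfolding flat_block_eq[OF A W] using R R' A by (meson mult_carrier_mat)
  have "0 \<le> (flat_block A W *\<^sub>v v) \<bullet>c v" if v: "v \<in> carrier_vec (N + m)" for v
  proof -
    have Rv: "?R *\<^sub>v v \<in> carrier_vec N" using R v by simp
    have "flat_block A W *\<^sub>v v = mat_adjoint ?R *\<^sub>v (A *\<^sub>v (?R *\<^sub>v v))"
      unfolding flat_block_eq[OF A W] assoc_mult_mat_vec[OF mult_carrier_mat[OF R' A] R v]
      by (rule assoc_mult_mat_vec[OF R' A Rv])
    then have "(flat_block A W *\<^sub>v v) \<bullet>c v = (A *\<^sub>v (?R *\<^sub>v v)) \<bullet>c (?R *\<^sub>v v)"
      using mat_adjoint_cscalar_prod[OF R _ v, of "A *\<^sub>v (?R *\<^sub>v v)"] A Rv by simp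
    then show ?thesis using \<open>psd A\<close> A Rv unfolding psd_def by auto
  qed
  then show ?thesis using c unfolding psd_def by auto
qed

text \<open>In this shape an entry can be read as a value of the Riesz functional through
  \<open>form_matrix_inner\<close>.\<close>

lemma index_flat_block:
  assumes A: "A \<in> carrier_mat N N" and W: "W \<in> carrier_mat N m" and ij: "i < N + m" "j < N + m"
  shows "flat_block A W $$ (i, j) = (A *\<^sub>v col (flat_cols W) j) \<bullet>c col (flat_cols W) i"
proof -
  let ?R = "flat_cols W"
  have R: "?R \<in> carrier_mat N (N + m)" and R': "mat_adjoint ?R \<in> carrier_mat (N + m) N"
    using W by auto
  have "flat_block A W = mat_adjoint ?R * (A * ?R)"
    unfolding flat_block_eq[OF A W] by (rule assoc_mult_mat[OF R' A R])
  then have "flat_block A W $$ (i, j) = row (mat_adjoint ?R) i \<bullet> col (A * ?R) j"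
    using R R' A ij by simp
  also have "row (mat_adjoint ?R) i = conjugate (col ?R i)"
    using carrier_matD[OF R] ij by (intro eq_vecI) (auto simp: index_mat_adjoint)
  also have "col (A * ?R) j = A *\<^sub>v col ?R j" by (rule col_mult2[OF A R ij(2)])
  also have "conjugate (col ?R i) \<bullet> (A *\<^sub>v col ?R j) = (A *\<^sub>v col ?R j) \<bullet>c col ?R i"
    by (rule conjugate_vec_sprod_comm[of _ N, symmetric]) (use A R ij in auto)
  finally show ?thesis .
qed

section \<open>Null polynomials of the Riesz functional, and localizing matrices\<close>

lemma riesz_diff: "riesz \<gamma> (f - g) = riesz \<gamma> f - riesz \<gamma> g"
  using riesz_add[of \<gamma> "f - g" g] by simp

lemma pconj_diff: "pconj (f - g) = pconj f - pconj g"
  using pconj_add[of "f - g" g] by (simp add: algebra_simps)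

lemma pconj_pconj [simp]: "pconj (pconj f) = f"
  by (rule poly_mapping_eqI) (auto simp: split_paired_all)

lemma pconj_const_mult:
  "pconj (Poly_Mapping.single 0 c * f) = Poly_Mapping.single 0 (cnj c) * pconj f"
  by (rule poly_mapping_eqI) (auto simp: split_paired_all lookup_const_mult)

lemma affine_nonneg_imp_slope_0:
  fixes a b :: real
  assumes "\<And>s. 0 \<le> s * a + b"
  shows "a = 0"
proof (rule ccontr)
  assume "a \<noteq> 0"
  \<comment> \<open>At this point the affine function takes the value -1.\<close>
  then show False using assms[of "(- b - 1) / a"] by simp
qed

text \<open>Since \<open>f\<close> is null, the form at \<open>t * f + g\<close> has no quadratic
  term in \<open>t\<close>; being nonnegative for every complex \<open>t\<close>, its linear part
  must vanish.\<close>

lemma riesz_null: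
  assumes pos: "\<And>f. 0 \<le> riesz \<gamma> (f * pconj f)" and f: "riesz \<gamma> (f * pconj f) = 0"
  shows "riesz \<gamma> (f * pconj g) = 0" and "riesz \<gamma> (g * pconj f) = 0"
proof -
  let ?X = "riesz \<gamma> (f * pconj g)" and ?Y = "riesz \<gamma> (g * pconj f)" and ?c = "riesz \<gamma> (g * pconj g)"
  have *: "0 \<le> t * ?X + cnj t * ?Y + ?c" for t
  proof -
    let ?S = "\<lambda>c. Poly_Mapping.single 0 c"
    let ?h = "?S t * f + g"
    have "?h * pconj ?h = ?S t * (?S (cnj t) * (f * pconj f)) + ?S t * (f * pconj g)
        + ?S (cnj t) * (g * pconj f) + g * pconj g"
      unfolding pconj_add pconj_const_mult by (simp add: algebra_simps)
    then have "riesz \<gamma> (?h * pconj ?h) = t * ?X + cnj t * ?Y + ?c"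
      by (simp only: riesz_add riesz_const_mult f mult_zero_right add_0)
    then show ?thesis using pos[of ?h] by simp
  qed
  \<comment> \<open>Nonnegativity in \<open>complex\<close> also forces the imaginary part to be 0.
    Real and imaginary \<open>t\<close> together give four real equations for \<open>?X\<close> and
    \<open>?Y\<close>.\<close>
  have re: "0 \<le> s * (Re ?X + Re ?Y) + Re ?c" "s * (Im ?X + Im ?Y) + Im ?c = 0" for s
    using *[of "of_real s"] by (auto simp: less_eq_complex_def algebra_simps)
  have im: "0 \<le> s * (Im ?Y - Im ?X) + Re ?c" "s * (Re ?X - Re ?Y) + Im ?c = 0" for s
    using *[of "\<i> * of_real s"] by (auto simp: less_eq_complex_def algebra_simps)
  have "Re ?X + Re ?Y = 0" "Im ?Y - Im ?X = 0"
    using affine_nonneg_imp_slope_0 re(1) im(1) by blast+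
  moreover have "Im ?X + Im ?Y = 0" "Re ?X - Re ?Y = 0"
    using re(2)[of 0] re(2)[of 1] im(2)[of 0] im(2)[of 1] by auto
  ultimately show "?X = 0" "?Y = 0" by (auto simp: complex_eq_iff)
qed

text \<open>The same \<open>W\<close> serves every \<open>p\<close> because the polynomials
  \<open>F j\<close> are built from \<open>W\<close> alone.\<close>

lemma form_matrix_flat_block:
  fixes \<gamma> :: "'d::{finite,linorder} mseq" and p :: "'d cpoly"
  assumes W: "W \<in> carrier_mat (card {m :: 'd monomial. mdeg m \<le> n}) (card {m :: 'd monomial. mdeg m = Suc n})"
    and pos: "\<And>f. 0 \<le> riesz \<gamma> (f * pconj f)"
    and flat: "form_matrix \<gamma> 1 (Suc n) = flat_block (form_matrix \<gamma> 1 n) W"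
  shows "form_matrix \<gamma> p (Suc n) = flat_block (form_matrix \<gamma> p n) W"
proof -
  define N where "N = length (monoms n :: 'd monomial list)"
  define m where "m = card {m :: 'd monomial. mdeg m = Suc n}"
  have W: "W \<in> carrier_mat N m" using W by (simp add: N_def m_def length_monoms)
  have len: "length (monoms (Suc n) :: 'd monomial list) = N + m"
    unfolding monoms_Suc length_append N_def m_def
    by (subst monoms.length_sorted_key_list_of_set)
      (auto intro: finite_subset[OF _ finite_mdeg_le[of "Suc n"]])
  \<comment> \<open>The ordering by degree puts the monomials of degree at most \<open>n\<close>
    first, so the list splits where the blocks do.\<close>
  have nth: "monoms (Suc n) ! a = (monoms n ! a :: 'd monomial)" if "a < N" for a
    using that by (simp add: monoms_Suc nth_append N_def)
  let ?R = "flat_cols W"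
  have R: "?R \<in> carrier_mat N (N + m)" using W by simp
  define M :: "nat \<Rightarrow> 'd cpoly" where "M j = mon (monoms (Suc n) ! j)" for j
  \<comment> \<open>Column \<open>j\<close> of \<open>R\<close> serves as the coefficient vector;
    only \<open>M a\<close> with \<open>a < N\<close> occur, which keeps the degree at most
    \<open>n\<close>.\<close>
  define F :: "nat \<Rightarrow> 'd cpoly" where
    "F j = (\<Sum>a<N. Poly_Mapping.single 0 (?R $$ (a, j)) * M a)" for j
  have lookM: "Poly_Mapping.lookup (M a) (monoms n ! b) = (if a = b then 1 else 0)"
    if "a < N" "b < N" for a b
    using that by (auto simp: M_def nth lookup_single when_def nth_eq_iff_index_eq N_def)
  have coeffF: "coeff_vec n (F j) = col ?R j" if "j < N + m" for j
  proof (rule eq_vecI)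
    fix b assume "b < dim_vec (col ?R j)"
    then have b: "b < N" using R by simp
    have "Poly_Mapping.lookup (F j) (monoms n ! b) = (\<Sum>a<N. if a = b then ?R $$ (a, j) else 0)"
      unfolding F_def lookup_sum lookup_const_mult by (intro sum.cong) (auto simp: lookM b)
    also have "\<dots> = ?R $$ (b, j)" using b by simp
    finally show "coeff_vec n (F j) $ b = col ?R j $ b"
      using b R that by (simp add: coeff_vec_def N_def[symmetric])
  qed (use R in \<open>simp add: coeff_vec_def N_def[symmetric]\<close>)
  have degF: "tdeg (F j) \<le> n" for j
    unfolding tdeg_le_iff
  proof
    fix x assume "x \<in> Poly_Mapping.keys (F j)"
    then have "(\<Sum>a<N. ?R $$ (a, j) * Poly_Mapping.lookup (M a) x) \<noteq> 0"
      by (simp add: F_def in_keys_iff lookup_sum lookup_const_mult)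
    then obtain a where a: "a < N" "Poly_Mapping.lookup (M a) x \<noteq> 0"
      by (metis (no_types, lifting) lessThan_iff mult_zero_right sum.neutral)
    then have "x = monoms n ! a" by (auto simp: M_def nth lookup_single when_def split: if_splits)
    then have "x \<in> set (monoms n)" using a(1) by (simp only: N_def nth_mem)
    then show "x \<in> {m. mdeg m \<le> n}" by simp
  qed
  have flat_entry: "flat_block (form_matrix \<gamma> q n) W $$ (i, j) = riesz \<gamma> (q * F j * pconj (F i))"
    if "i < N + m" "j < N + m" for q :: "'d cpoly" and i j
    using index_flat_block[OF form_matrix_carrier[of \<gamma> q n, folded N_def] W that]
      form_matrix_inner[OF degF degF, of \<gamma> q j i] coeffF that by simp
  have entry: "form_matrix \<gamma> q (Suc n) $$ (i, j) = riesz \<gamma> (q * M j * pconj (M i))"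
    if "i < N + m" "j < N + m" for q :: "'d cpoly" and i j
    using that by (simp add: form_matrix_def Let_def len M_def)
  have eq: "riesz \<gamma> (M j * pconj (M i)) = riesz \<gamma> (F j * pconj (F i))"
    if "i < N + m" "j < N + m" for i j
    using flat_entry[OF that, of 1] entry[OF that, of 1] flat by simp
  \<comment> \<open>The left block of \<open>R\<close> is the identity.\<close>
  have F_eq_M: "F a = M a" if "a < N" for a
  proof -
    have "F a = (\<Sum>b<N. if b = a then M b else 0)"
      unfolding F_def using that
      by (intro sum.cong) (auto simp: flat_cols_unit[OF W])
    then show ?thesis using that by simp
  qed
  have expand_left: "riesz \<gamma> (F j * h) = (\<Sum>a<N. ?R $$ (a, j) * riesz \<gamma> (M a * h))" for j h
    by (simp add: F_def sum_distrib_right riesz_sum mult.assoc riesz_const_mult)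
  have expand_right: "riesz \<gamma> (h * pconj (F i)) = (\<Sum>a<N. cnj (?R $$ (a, i)) * riesz \<gamma> (h * pconj (M a)))" for i h
    by (simp add: F_def sum_distrib_left pconj_sum pconj_const_mult riesz_sum mult.left_commute[of h] riesz_const_mult)
  \<comment> \<open>Both sides expand along \<open>F i\<close> into terms with \<open>M a\<close>,
    \<open>a < N\<close>. There \<open>eq\<close> applies, and \<open>F a = M a\<close>. The next
    fact does the same in the first argument.\<close>
  have M_F: "riesz \<gamma> (M j * pconj (F i)) = riesz \<gamma> (F j * pconj (F i))" if "j < N + m" for i j
    unfolding expand_right using that by (intro sum.cong) (auto simp: eq F_eq_M)
  have F_M: "riesz \<gamma> (F j * pconj (M i)) = riesz \<gamma> (F j * pconj (F i))" if "i < N + m" for i j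
    unfolding expand_left using that by (intro sum.cong) (auto simp: eq F_eq_M)
  \<comment> \<open>All four pairings of \<open>M j\<close> and \<open>F j\<close> have the same
    value and cancel in the expansion.\<close>
  have null: "riesz \<gamma> ((M j - F j) * pconj (M j - F j)) = 0" if "j < N + m" for j
    using that by (simp add: pconj_diff riesz_diff left_diff_distrib right_diff_distrib eq M_F F_M)
  \<comment> \<open>Here \<open>h\<close> has unrestricted degree, which leaves room for the factor
    \<open>p\<close>.\<close>
  have left: "riesz \<gamma> (M j * h) = riesz \<gamma> (F j * h)" if "j < N + m" for j h
    using riesz_null(1)[OF pos null[OF that], of "pconj h"] by (simp add: left_diff_distrib riesz_diff)
  have right: "riesz \<gamma> (h * pconj (M i)) = riesz \<gamma> (h * pconj (F i))" if "i < N + m" for i h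
    using riesz_null(2)[OF pos null[OF that], of h]
    by (simp add: pconj_diff right_diff_distrib riesz_diff)
  show ?thesis
  proof (rule eq_matI)
    fix i j
    assume "i < dim_row (flat_block (form_matrix \<gamma> p n) W)" "j < dim_col (flat_block (form_matrix \<gamma> p n) W)"
    then have ij: "i < N + m" "j < N + m"
      using W form_matrix_carrier[of \<gamma> p n] by (auto simp: flat_block_def N_def)
    \<comment> \<open>First \<open>M j\<close> is replaced, with \<open>p * pconj (M i)\<close> as
      cofactor, then \<open>M i\<close>, with cofactor \<open>p * F j\<close>.\<close>
    have "riesz \<gamma> (p * M j * pconj (M i)) = riesz \<gamma> (M j * (p * pconj (M i)))" by (simp add: mult_ac)
    also have "\<dots> = riesz \<gamma> (F j * (p * pconj (M i)))" by (rule left[OF ij(2)])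
    also have "\<dots> = riesz \<gamma> (p * F j * pconj (M i))" by (simp add: mult_ac)
    also have "\<dots> = riesz \<gamma> (p * F j * pconj (F i))" by (rule right[OF ij(1)])
    finally show "form_matrix \<gamma> p (Suc n) $$ (i, j) = flat_block (form_matrix \<gamma> p n) W $$ (i, j)"
      by (simp only: entry[OF ij] flat_entry[OF ij])
  qed (use W form_matrix_carrier[of \<gamma> p n] form_matrix_carrier[of \<gamma> p "Suc n"]
      in \<open>auto simp: flat_block_def N_def[symmetric] len\<close>)
qed

section \<open>Moment matrices: dependence on low moments, and positivity of the functional\<close>

lemma form_matrix_1_cong:
  fixes \<gamma> \<gamma>' :: "'d::{finite,linorder} mseq"
  assumes "\<And>x :: 'd monomial. mdeg x \<le> 2 * l \<Longrightarrow> \<gamma> x = \<gamma>' x"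
  shows "form_matrix \<gamma> 1 l = form_matrix \<gamma>' 1 l"
proof (rule eq_matI)
  fix i j assume "i < dim_row (form_matrix \<gamma>' 1 l)" "j < dim_col (form_matrix \<gamma>' 1 l)"
  then have ij: "i < length (monoms l :: 'd monomial list)" "j < length (monoms l :: 'd monomial list)"
    by (auto simp: form_matrix_def Let_def)
  \<comment> \<open>Conjugation swaps the two exponents, so entry \<open>(i, j)\<close> is the
    single moment at \<open>?x\<close>.\<close>
  let ?x = "monoms l ! j + prod.swap (monoms l ! i) :: 'd monomial"
  have "(monoms l ! i :: 'd monomial) \<in> set (monoms l)" "(monoms l ! j :: 'd monomial) \<in> set (monoms l)"
    using ij nth_mem by blast+
  then have "mdeg ?x \<le> 2 * l"
    by (simp add: mdeg_def sum.distrib)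
  then have "riesz \<gamma> (Poly_Mapping.single ?x 1) = riesz \<gamma>' (Poly_Mapping.single ?x 1)"
    using assms by (simp add: riesz_def)
  then show "form_matrix \<gamma> 1 l $$ (i, j) = form_matrix \<gamma>' 1 l $$ (i, j)"
    using ij by (simp add: form_matrix_def Let_def pconj_mon mult_single)
qed (auto simp: form_matrix_def Let_def)

lemma riesz_mult_pconj_nonneg:
  fixes f :: "'d::{finite,linorder} cpoly"
  assumes psd: "\<And>l. l \<ge> l0 \<Longrightarrow> psd (moment_matrix \<gamma> l)"
  shows "0 \<le> riesz \<gamma> (f * pconj f)"
proof -
  \<comment> \<open>The order must be large enough both to hold \<open>f\<close> and to fall in the
    range where positivity is known.\<close>
  define l where "l = max l0 (tdeg f)"
  have f: "tdeg f \<le> l" by (simp add: l_def)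
  have "coeff_vec l f \<in> carrier_vec (dim_row (form_matrix \<gamma> 1 l))"
    by (simp add: coeff_vec_def form_matrix_def Let_def)
  then have "0 \<le> (form_matrix \<gamma> 1 l *\<^sub>v coeff_vec l f) \<bullet>c coeff_vec l f"
    using psd[of l] unfolding psd_def moment_matrix_def l_def by auto
  then show ?thesis using form_matrix_inner[OF f f, of \<gamma> 1] by simp
qed

section \<open>Rank and flatness of the block extension\<close>

lemma mat_rank_flat_block:
  assumes A: "A \<in> carrier_mat N N" and W: "W \<in> carrier_mat N m"
  shows "mat_rank (flat_block A W) = mat_rank A"
proof (rule antisym)
  have R: "flat_cols W \<in> carrier_mat N (N + m)" using W by simp
  show "mat_rank (flat_block A W) \<le> mat_rank A"
    unfolding flat_block_eq[OF A W]
    by (rule mat_rank_mult_mult_le[OF mat_adjoint_carrier[OF R] A R])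
  \<comment> \<open>For the reverse inequality, \<open>?J = (I 0)\<close> and its transpose
    \<open>?K\<close> cut out the upper-left corner \<open>A\<close>.\<close>
  let ?J = "mat N (N + m) (\<lambda>(i, j). if i = j then 1 else 0) :: complex mat"
  let ?K = "mat (N + m) N (\<lambda>(i, j). if i = j then 1 else 0) :: complex mat"
  have F: "flat_block A W \<in> carrier_mat (N + m) (N + m)"
    using A W by (auto simp: flat_block_def)
  have "A = ?J * flat_block A W * ?K"
  proof (rule eq_matI)
    fix i j assume "i < dim_row (?J * flat_block A W * ?K)" "j < dim_col (?J * flat_block A W * ?K)"
    then have ij: "i < N" "j < N" by auto
    have JF: "(?J * flat_block A W) $$ (i, b) = flat_block A W $$ (i, b)" if "b < N + m" for b
    proof -
      have "(?J * flat_block A W) $$ (i, b)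
        = (\<Sum>a<N + m. if i = a then flat_block A W $$ (a, b) else 0)"
        using F ij that
        by (simp add: scalar_prod_def atLeast0LessThan if_distribR if_distrib cong: if_cong)
      then show ?thesis using ij by simp
    qed
    have "(?J * flat_block A W * ?K) $$ (i, j) = (\<Sum>b<N + m. (?J * flat_block A W) $$ (i, b) * ?K $$ (b, j))"
      using F ij by (simp add: scalar_prod_def atLeast0LessThan)
    also have "\<dots> = (\<Sum>b<N + m. if b = j then flat_block A W $$ (i, b) else 0)"
      using ij by (intro sum.cong) (auto simp: JF simp del: index_mult_mat)
    also have "\<dots> = flat_block A W $$ (i, j)" using ij by simp
    also have "\<dots> = A $$ (i, j)" using A W ij by (simp add: flat_block_def)
    finally show "A $$ (i, j) = (?J * flat_block A W * ?K) $$ (i, j)" by simp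
  qed (use A in auto)
  then show "mat_rank A \<le> mat_rank (flat_block A W)"
    using mat_rank_mult_mult_le[of ?J N "N + m" "flat_block A W" "N + m" ?K N] F by simp
qed

lemma flat_extension_flat_block:
  assumes A: "A \<in> carrier_mat N N" and W: "W \<in> carrier_mat N m" and "psd A"
  shows "flat_extension A (flat_block A W)"
proof -
  have "block_extension A (flat_block A W)"
    unfolding block_extension_def flat_block_def
    by (rule exI[of _ m], rule exI[of _ "A * W"], rule exI[of _ "mat_adjoint W * A"],
        rule exI[of _ "mat_adjoint W * A * W"])
      (use A W mat_adjoint_carrier[OF W] in auto)
  then show ?thesis
    using psd_flat_block[OF assms] mat_rank_flat_block[OF A W] by (simp add: flat_extension_def)
qed

theorem theorem4p1:
  fixes \<gamma> \<gamma>' \<gamma>t :: "'d::{finite,linorder} mseq"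
    and p :: "'d cpoly"
    and W :: "complex mat"
    and n k :: nat
  assumes "psd (moment_matrix \<gamma> n)"
    and "extends_seq (2 * n) \<gamma> \<gamma>'"
    and "flat_extension (moment_matrix \<gamma> n) (moment_matrix \<gamma>' (n + 1))"
    and "W \<in> carrier_mat (card {m :: 'd monomial. mdeg m \<le> n})
                          (card {m :: 'd monomial. mdeg m = n + 1})"
    and "moment_matrix \<gamma>' (n + 1) = flat_block (moment_matrix \<gamma> n) W"
    and "full_flat_extension (n + 1) \<gamma>' \<gamma>t"
    and "tdeg p = 2 * k \<or> tdeg p + 1 = 2 * k"
    and "psd (localizing_matrix \<gamma>t p (n + k))"
  shows "localizing_matrix \<gamma>t p (n + k + 1) = flat_block (localizing_matrix \<gamma>t p (n + k)) W
    \<and> flat_extension (localizing_matrix \<gamma>t p (n + k)) (localizing_matrix \<gamma>t p (n + k + 1))"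
proof -
  \<comment> \<open>Both \<open>(2 * k + 1) div 2\<close> and \<open>(2 * k) div 2\<close> equal
    \<open>k\<close>, so the two localizing matrices are form matrices of orders \<open>n\<close>
    and \<open>Suc n\<close>.\<close>
  have k: "half_deg p = k" using assms(7) by (auto simp: half_deg_def)
  have loc: "localizing_matrix \<gamma>t p (n + k) = form_matrix \<gamma>t p n"
    "localizing_matrix \<gamma>t p (n + k + 1) = form_matrix \<gamma>t p (Suc n)"
    by (simp_all add: localizing_matrix_def k)
  have ext: "\<gamma>t x = \<gamma>' x" if "mdeg x \<le> 2 * Suc n" for x
    using assms(6) that unfolding full_flat_extension_def extends_seq_def by (simp only: Suc_eq_plus1)
  have "\<gamma>t x = \<gamma> x" if "mdeg x \<le> 2 * n" for x
    using assms(2) ext[of x] that by (cases x) (simp add: extends_seq_def)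
  then have "form_matrix \<gamma>t 1 n = form_matrix \<gamma> 1 n"
    by (rule form_matrix_1_cong)
  moreover have "form_matrix \<gamma>t 1 (Suc n) = form_matrix \<gamma>' 1 (Suc n)"
    by (rule form_matrix_1_cong) (rule ext)
  \<comment> \<open>The flat block form, given for \<open>\<gamma>\<close> and
    \<open>\<gamma>'\<close>, now concerns the single sequence \<open>\<gamma>t\<close>.\<close>
  ultimately have flat: "form_matrix \<gamma>t 1 (Suc n) = flat_block (form_matrix \<gamma>t 1 n) W"
    using assms(5) by (simp add: moment_matrix_def)
  \<comment> \<open>Each flat extension step from order \<open>j \<ge> n + 1\<close> records
    positivity of the larger matrix, of order \<open>j + 1\<close>; hence the bound
    \<open>n + 2\<close>.\<close>
  have psd: "psd (moment_matrix \<gamma>t l)" if "l \<ge> n + 2" for l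
  proof -
    from that have l: "l - 1 \<ge> n + 1" "l - 1 + 1 = l" by auto
    then have "flat_extension (moment_matrix \<gamma>t (l - 1)) (moment_matrix \<gamma>t (l - 1 + 1))"
      using assms(6) unfolding full_flat_extension_def by blast
    then show ?thesis unfolding l(2) flat_extension_def by simp
  qed
  have pos: "0 \<le> riesz \<gamma>t (f * pconj f)" for f
    by (rule riesz_mult_pconj_nonneg) (rule psd)
  have "form_matrix \<gamma>t p (Suc n) = flat_block (form_matrix \<gamma>t p n) W"
    by (rule form_matrix_flat_block) (use assms(4) pos flat in auto)
  moreover have "flat_extension (form_matrix \<gamma>t p n) (flat_block (form_matrix \<gamma>t p n) W)"
    using flat_extension_flat_block[OF form_matrix_carrier] assms(4,8)
    by (simp add: length_monoms loc)
  ultimately show ?thesis unfolding loc by simp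
qed

end
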